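(* Let $G$ be a finite abelian group such that $|G|$ is a prime power. Then $\mathcal P(G)=\mathcal D(G)$.
   Context: Let $G$ be a finite abelian group of order $n$, written additively, and let $x_g$ ($g\in G$) be commuting indeterminates. The Cayley table of $G$ is the $G\times G$ matrix $\mathcal M_G=(x_{a+b})_{a,b\in G}$ (rows and columns are identified with $G$). Thus $\operatorname{per}(\mathcal M_G)=\sum_{\sigma\in\mathfrak S(G)}\prod_{a\in G}x_{a+\sigma(a)}$ and $\det(\mathcal M_G)=\sum_{\sigma\in\mathfrak S(G)}\operatorname{sgn}(\sigma)\prod_{a\in G}x_{a+\sigma(a)}$, where $\mathfrak S(G)$ is the group of all permutations of the set $G$. $\mathcal P(G)$ denotes the number of formally different monomials in the $x_g$ occurring (i.e. having nonzero coefficient after collecting terms, with integer coefficients) in the polynomial $\operatorname{per}(\mathcal M_G)$, and $\mathcal D(G)$ denotes the number of formally different monomials occurring in the polynomial $\det(\mathcal M_G)$. *)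

theory Defs
  imports "HOL-Analysis.Determinants" "HOL-Library.Poly_Mapping" "HOL-Number_Theory.Prime_Powers"
begin

text \<open>
  Integer polynomials in commuting indeterminates indexed by \<open>'v\<close>: a monomial is its
  finitely supported exponent function, and a polynomial is a finitely supported
  coefficient function on monomials, with the convolution product of
  \<^theory>\<open>HOL-Library.Poly_Mapping\<close>.
\<close>

type_synonym 'v monomial = "'v \<Rightarrow>\<^sub>0 nat"
type_synonym 'v intpoly = "'v monomial \<Rightarrow>\<^sub>0 int"

definition indet :: "'v \<Rightarrow> 'v intpoly" where
  "indet v = Poly_Mapping.single (Poly_Mapping.single v 1) 1"

definition num_monomials :: "'v intpoly \<Rightarrow> nat" where
  "num_monomials p = card (Poly_Mapping.keys p)"

text \<open>The sum of \<^const>\<open>det\<close> without the signs.\<close>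

definition permanent :: "'a::comm_ring_1^'n^'n \<Rightarrow> 'a" where
  "permanent A = (\<Sum>\<sigma> | \<sigma> permutes (UNIV :: 'n set). \<Prod>i\<in>UNIV. A $ i $ \<sigma> i)"

definition cayley_table :: "'g intpoly^('g::{finite,ab_group_add})^('g::{finite,ab_group_add})" where
  "cayley_table = (\<chi> a b. indet (a + b))"

definition per_monomials :: "'g::{finite,ab_group_add} itself \<Rightarrow> nat" where
  "per_monomials _ = num_monomials (permanent (cayley_table :: 'g intpoly^('g::{finite,ab_group_add})^('g::{finite,ab_group_add})))"

definition det_monomials :: "'g::{finite,ab_group_add} itself \<Rightarrow> nat" where
  "det_monomials _ = num_monomials (det (cayley_table :: 'g intpoly^('g::{finite,ab_group_add})^('g::{finite,ab_group_add})))"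

end

theory Submission
  imports Defs
begin

text \<open>
  Every monomial of the determinant is one of the permanent, because the coefficients of the
  determinant are signed versions of the counts in the permanent. The content is that no
  cancellation in the determinant is complete. A monomial of the permanent is
  $\prod_a x_{g(a)}$ with $g(a) = a + \sigma(a)$, and such a $g$ has sum
  $2 \sum_a a = 0$. So it suffices that the determinant has a nonzero coefficient at the
  monomial of every $g : G \to G$ with sum $0$ when $N = |G|$ is a power of a prime $p$.

  That coefficient, multiplied by the positive number of permutations that fix $g$, is the
  polarized determinant
  $D(g) = \sum_{\alpha,\beta} \mathrm{sgn}(\alpha)\,\mathrm{sgn}(\beta)$, summed over the pairs of
  permutations with $\alpha + \beta = g$ (\<open>polarized_det_eq_coefficient\<close>). It is a
  symmetric function of the $N$ values of $g$. For $h \neq 0$, adding $h$ to the values one at a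
  time gives $\sum_i D(g + h e_i) = 0$: the contributions cancel in pairs that differ by a
  transposition (\<open>sum_polarized_det_shift\<close>).

  Together with $|D(0)| = N!$ this relation determines $D$ up to a sign. Restricting $g$ to a set
  $A$ (with value $0$ elsewhere) and dividing by $(N - |A|)!$ yields a number $F(A, g)$ that
  satisfies a recursion merging one element of $A$ with another (\<open>reduced_det_merge\<close>).
  Unwinding it gives, up to a global sign,
  $F(A, g) = \sum_\pi \mathrm{sgn}(\pi)\, N^{c(\pi)}$, where $\pi$ runs over the permutations of
  $A$ all of whose cycles have $g$-sum $0$ and $c(\pi)$ is the number of cycles. The lemma
  \<open>reduced_det_block\<close> is this formula sorted by the cycle through a chosen element.

  If $g$ has sum $0$ on $A$ and $|A| = r$, then the permutations with one cycle contribute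
  $\pm N (r-1)!$. Every further cycle costs a factor of the form
  $N\, s!\, t! / (s+t+1)!$ with $s + t + 1 < N = p^k$, and this is divisible by $p$
  because $(s+t+1)!/(s!\,t!)$ divides the least common multiple of $1, \dots, s+t+1$, which is not
  divisible by $p^k$ (\<open>multiplicity_fact_Suc_add_less\<close>). Hence the $p$-adic valuation
  of $F(A, g)$ is exactly that of $N (r-1)!$, so $F(A, g) \neq 0$; the case
  $A = G$ is the claim.
\<close>

section \<open>A $p$-adic bound for $(s+t+1)!/(s!\,t!)$\<close>

text \<open>
  The Beta values $B(s,t) = s!\,t!/(s+t+1)!$ satisfy $B(s,t+1) = B(s,t) - B(s+1,t)$ and
  $B(s,0) = 1/(s+1)$. They are therefore integer combinations of $1/i$ with
  $1 \le i \le s+t+1$, so a common multiple $L$ of these $i$ clears the denominator.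
\<close>
lemma fact_Suc_add_dvd_mult_fact:
  fixes L :: nat
  assumes "\<And>i. 1 \<le> i \<Longrightarrow> i \<le> Suc (s + t) \<Longrightarrow> i dvd L"
  shows "fact (Suc (s + t)) dvd L * (fact s * fact t)"
  using assms
proof (induction t arbitrary: s)
  case 0
  have "Suc s dvd L" using 0[of "Suc s"] by simp
  then have "Suc s * fact s dvd L * fact s" by (rule mult_dvd_mono) simp
  then show ?case by simp
next
  case (Suc t)
  let ?M = "Suc (Suc (s + t))"
  have "fact (Suc (s + t)) dvd L * (fact s * fact t)"
    by (rule Suc.IH) (use Suc.prems in auto)
  then have "?M * fact (Suc (s + t)) dvd ?M * (L * (fact s * fact t))"
    by (rule mult_dvd_mono[OF dvd_refl])
  then have 1: "fact ?M dvd ?M * (L * (fact s * fact t))"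
    by (simp only: fact_Suc[of "Suc (s + t)"] of_nat_id)
  have "fact (Suc (Suc s + t)) dvd L * (fact (Suc s) * fact t)"
    by (rule Suc.IH) (use Suc.prems in auto)
  then have 2: "fact ?M dvd Suc s * (L * (fact s * fact t))"
    by (simp only: add_Suc add_Suc_right fact_Suc[of s] of_nat_id ac_simps)
  have "fact ?M dvd ?M * (L * (fact s * fact t)) - Suc s * (L * (fact s * fact t))"
    using 1 2 by (rule dvd_diff_nat)
  also have "?M * (L * (fact s * fact t)) - Suc s * (L * (fact s * fact t))
      = Suc t * (L * (fact s * fact t))"
    by (metis add_Suc add_Suc_right diff_add_inverse diff_mult_distrib)
  also have "\<dots> = L * (fact s * fact (Suc t))"
    by (simp only: fact_Suc[of t] of_nat_id ac_simps)
  finally show ?case by (simp only: add_Suc_right)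
qed

text \<open>
  Each $i < p^k$ contains $p$ at most $k - 1$ times, so a common multiple of the numbers up to
  $s+t+1$ can be chosen with $p$-adic valuation $k - 1$.
\<close>
lemma multiplicity_fact_Suc_add_less:
  fixes p :: nat
  assumes p: "prime p" and lt: "Suc (s + t) < p ^ k"
  shows "multiplicity p (fact (Suc (s + t)) :: nat)
      < k + multiplicity p (fact s * fact t :: nat)"
proof -
  let ?M = "Suc (s + t)"
  have "\<exists>u. i = p ^ multiplicity p i * u \<and> \<not> p dvd u" if "i \<in> {1..?M}" for i
    using multiplicity_decompose'[of i p] p that
    by (metis One_nat_def atLeastAtMost_iff not_one_le_zero not_prime_unit)
  then obtain u where u: "i = p ^ multiplicity p i * u i" "\<not> p dvd u i" if "i \<in> {1..?M}" for i
    by metis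
  \<comment> \<open>A multiple of every \<open>i\<close> up to \<open>s + t + 1\<close> with valuation exactly \<open>k - 1\<close>: a
    power of \<open>p\<close> large enough for all of them, times all their parts prime to \<open>p\<close>.\<close>
  define L where "L = p ^ (k - 1) * (\<Prod>i\<in>{1..?M}. u i)"
  have "i dvd L" if "1 \<le> i" "i \<le> ?M" for i
  proof -
    have i: "i \<in> {1..?M}" using that by simp
    have "p ^ multiplicity p i \<le> i"
      using i by (intro dvd_imp_le multiplicity_dvd) auto
    also have "\<dots> < p ^ k" using that lt by simp
    finally have "multiplicity p i < k"
      using p by (simp add: prime_gt_Suc_0_nat)
    then have "p ^ multiplicity p i dvd p ^ (k - 1)" by (intro le_imp_power_dvd) simp
    moreover have "u i dvd (\<Prod>i\<in>{1..?M}. u i)" using i by (intro dvd_prodI) auto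
    ultimately have "p ^ multiplicity p i * u i dvd L" unfolding L_def by (rule mult_dvd_mono)
    then show ?thesis using u(1)[OF i] by simp
  qed
  then have "fact ?M dvd L * (fact s * fact t)" by (rule fact_Suc_add_dvd_mult_fact)
  with multiplicity_dvd have "p ^ multiplicity p (fact ?M :: nat) dvd L * (fact s * fact t)"
    by (rule dvd_trans)
  then have "p ^ multiplicity p (fact ?M :: nat)
      dvd (\<Prod>i\<in>{1..?M}. u i) * (p ^ (k - 1) * (fact s * fact t))"
    by (simp only: L_def ac_simps)
  moreover have "\<not> p dvd (\<Prod>i\<in>{1..?M}. u i)"
    using p u(2) by (subst prime_dvd_prod_iff) auto
  then have "coprime (p ^ multiplicity p (fact ?M :: nat)) (\<Prod>i\<in>{1..?M}. u i)"
    by (intro coprime_power_left_iff[THEN iffD2] disjI1 prime_imp_coprime[OF p])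
  ultimately have "p ^ multiplicity p (fact ?M :: nat) dvd p ^ (k - 1) * (fact s * fact t)"
    by (simp add: coprime_dvd_mult_right_iff)
  then have "multiplicity p (fact ?M :: nat) \<le> multiplicity p (p ^ (k - 1) * (fact s * fact t) :: nat)"
    using p by (intro multiplicity_geI) (auto simp: not_prime_unit)
  also have "\<dots> = (k - 1) + multiplicity p (fact s * fact t :: nat)"
    using p by (subst prime_elem_multiplicity_mult_distrib) (auto simp: )
  finally show ?thesis
    using lt by (cases k) auto
qed

section \<open>The polarized determinant\<close>

text \<open>
  The sign extended by $0$ to all self-maps: the determinant of the $0$-$1$ matrix of \<open>f\<close>.
\<close>
definition perm_sign :: "('g::finite \<Rightarrow> 'g) \<Rightarrow> int" where
  "perm_sign f = (if f permutes UNIV then sign f else 0)"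

lemma perm_sign_not_inj: "f i = f j \<Longrightarrow> i \<noteq> j \<Longrightarrow> perm_sign f = 0"
  by (auto simp: perm_sign_def dest: permutes_inj injD)

lemma perm_sign_compose:
  assumes "\<gamma> permutes (UNIV :: 'g::finite set)"
  shows "perm_sign (f \<circ> \<gamma>) = perm_sign f * sign \<gamma>"
proof (cases "f permutes UNIV")
  case True
  then show ?thesis using assms
    by (simp add: perm_sign_def permutes_compose sign_compose permutation_permutes[THEN iffD2, OF exI[of _ "UNIV::'g set"]])
next
  case False
  have "\<not> (f \<circ> \<gamma>) permutes UNIV"
  proof
    assume "(f \<circ> \<gamma>) permutes UNIV"
    then have "(f \<circ> \<gamma>) \<circ> inv \<gamma> permutes UNIV"
      by (rule permutes_compose[OF permutes_inv[OF assms]])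
    then show False using False assms by (simp add: comp_assoc permutes_inv_o)
  qed
  then show ?thesis using False by (simp add: perm_sign_def)
qed

text \<open>
  If \<open>f\<close> is injective, then shifting one value produces a collision, so every term is $0$. If
  \<open>f i = f j\<close> with \<open>i \<noteq> j\<close>, then only the shifts at \<open>i\<close> and \<open>j\<close> can remove the collision, and
  the two results differ by a transposition.
\<close>
lemma sum_perm_sign_shift:
  fixes f :: "'g::{finite,ab_group_add} \<Rightarrow> 'g"
  assumes "h \<noteq> 0"
  shows "(\<Sum>i\<in>UNIV. perm_sign (f(i := f i + h))) = 0"
proof (cases "inj f")
  case True
  have "perm_sign (f(i := f i + h)) = 0" for i
  proof -
    obtain j where j: "f j = f i + h"
      using finite_UNIV_inj_surj[OF finite True] by (metis surjD)
    then have "j \<noteq> i" using assms by auto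
    then show ?thesis using j by (intro perm_sign_not_inj[of _ i j]) auto
  qed
  then show ?thesis by simp
next
  case False
  then obtain i j where ij: "f i = f j" "i \<noteq> j" by (auto simp: inj_def)
  have zero: "perm_sign (f(k := f k + h)) = 0" if "k \<in> UNIV - {i, j}" for k
    using ij that by (intro perm_sign_not_inj[of _ i j]) auto
  have "f(j := f j + h) = f(i := f i + h) \<circ> Transposition.transpose i j"
    using ij by (auto simp: fun_eq_iff Transposition.transpose_def)
  then have "perm_sign (f(j := f j + h)) = - perm_sign (f(i := f i + h))"
    using ij by (simp add: perm_sign_compose permutes_swap_id sign_swap_id)
  moreover have "(\<Sum>k\<in>UNIV. perm_sign (f(k := f k + h)))
      = (\<Sum>k\<in>{i, j}. perm_sign (f(k := f k + h)))"
    using zero by (intro sum.mono_neutral_right) auto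
  ultimately show ?thesis using ij by simp
qed

text \<open>
  The sum of \<open>sign \<alpha> * sign \<beta>\<close> over the pairs of permutations with \<open>\<alpha> + \<beta> = g\<close>; the second
  permutation is determined by the first.
\<close>
definition polarized_det :: "('g::{finite,ab_group_add} \<Rightarrow> 'g) \<Rightarrow> int" where
  "polarized_det g = (\<Sum>\<alpha> | \<alpha> permutes UNIV. sign \<alpha> * perm_sign (\<lambda>i. g i - \<alpha> i))"

lemma sum_polarized_det_shift:
  fixes g :: "'g::{finite,ab_group_add} \<Rightarrow> 'g"
  assumes "h \<noteq> 0"
  shows "(\<Sum>i\<in>UNIV. polarized_det (g(i := g i + h))) = 0"
proof -
  have "(\<Sum>i\<in>UNIV. polarized_det (g(i := g i + h)))
      = (\<Sum>\<alpha> | \<alpha> permutes UNIV. sign \<alpha> * (\<Sum>i\<in>UNIV. perm_sign (\<lambda>j. (g(i := g i + h)) j - \<alpha> j)))"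
    unfolding polarized_det_def by (subst sum.swap) (simp add: sum_distrib_left)
  also have "\<dots> = 0"
  proof (intro sum.neutral ballI)
    fix \<alpha> :: "'g \<Rightarrow> 'g"
    have "(\<lambda>j. (g(i := g i + h)) j - \<alpha> j) = (\<lambda>j. g j - \<alpha> j)(i := (g i - \<alpha> i) + h)" for i
      by (auto simp: fun_eq_iff)
    then show "sign \<alpha> * (\<Sum>i\<in>UNIV. perm_sign (\<lambda>j. (g(i := g i + h)) j - \<alpha> j)) = 0"
      using sum_perm_sign_shift[OF assms, of "\<lambda>j. g j - \<alpha> j"] by simp
  qed
  finally show ?thesis .
qed

lemma polarized_det_compose:
  assumes "\<gamma> permutes (UNIV :: 'g::{finite,ab_group_add} set)"
  shows "polarized_det (g \<circ> \<gamma>) = polarized_det g"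
proof -
  have "polarized_det (g \<circ> \<gamma>)
      = (\<Sum>\<alpha> | \<alpha> permutes UNIV. sign (\<alpha> \<circ> \<gamma>) * perm_sign ((\<lambda>i. g i - \<alpha> i) \<circ> \<gamma>))"
    unfolding polarized_det_def by (subst sum_permutations_compose_right[OF assms]) (simp add: comp_def)
  also have "\<dots> = (\<Sum>\<alpha> | \<alpha> permutes UNIV. sign \<alpha> * perm_sign (\<lambda>i. g i - \<alpha> i))"
  proof (rule sum.cong[OF refl])
    fix \<alpha> :: "'g \<Rightarrow> 'g" assume "\<alpha> \<in> {\<alpha>. \<alpha> permutes UNIV}"
    then have a: "\<alpha> permutes UNIV" by simp
    have "sign (\<alpha> \<circ> \<gamma>) = sign \<alpha> * sign \<gamma>"
      using perm_sign_compose[OF assms, of \<alpha>] a permutes_compose[OF assms a]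
      by (simp add: perm_sign_def)
    then show "sign (\<alpha> \<circ> \<gamma>) * perm_sign ((\<lambda>i. g i - \<alpha> i) \<circ> \<gamma>)
        = sign \<alpha> * perm_sign (\<lambda>i. g i - \<alpha> i)"
      by (simp add: perm_sign_compose[OF assms])
  qed
  finally show ?thesis by (simp add: polarized_det_def)
qed

text \<open>
  For \<open>g = 0\<close> the pairs are \<open>(\<alpha>, - \<alpha>)\<close>, and they all have the sign of the negation map.
\<close>
lemma abs_polarized_det_zero:
  "\<bar>polarized_det (\<lambda>_::'g::{finite,ab_group_add}. 0)\<bar> = fact CARD('g)"
proof -
  have u: "(uminus :: 'g \<Rightarrow> 'g) permutes UNIV"
    by (intro bij_imp_permutes) (auto simp: bij_uminus)
  have "polarized_det (\<lambda>_::'g. 0) = (\<Sum>\<alpha> | \<alpha> permutes (UNIV::'g set). sign (uminus :: 'g \<Rightarrow> 'g))"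
    unfolding polarized_det_def
  proof (rule sum.cong[OF refl])
    fix \<alpha> :: "'g \<Rightarrow> 'g" assume "\<alpha> \<in> {\<alpha>. \<alpha> permutes UNIV}"
    then have a: "\<alpha> permutes UNIV" by simp
    have "perm_sign (\<lambda>i. 0 - \<alpha> i) = perm_sign (uminus \<circ> \<alpha>)" by (simp add: comp_def)
    also have "\<dots> = sign (uminus :: 'g \<Rightarrow> 'g) * sign \<alpha>"
      using u by (simp add: perm_sign_compose[OF a]) (simp add: perm_sign_def)
    finally show "sign \<alpha> * perm_sign (\<lambda>i. 0 - \<alpha> i) = sign (uminus :: 'g \<Rightarrow> 'g)" by simp
  qed
  also have "\<dots> = fact CARD('g) * sign (uminus :: 'g \<Rightarrow> 'g)"
    by (simp add: card_permutations[OF refl finite])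
  finally show ?thesis by (cases "uminus :: 'g \<Rightarrow> 'g" rule: sign_cases) simp_all
qed

section \<open>Recursions for the restricted determinant\<close>

text \<open>
  The factorial counts the arrangements of the \<open>CARD('g) - card A\<close> zeros outside \<open>A\<close>. After
  division by it the recursions below have integer coefficients that depend on the group only
  through its order, and the values are integers.
\<close>
definition reduced_det :: "'g::{finite,ab_group_add} set \<Rightarrow> ('g \<Rightarrow> 'g) \<Rightarrow> rat" where
  "reduced_det A g =
    of_int (polarized_det (\<lambda>i. if i \<in> A then g i else 0)) / fact (CARD('g) - card A)"

lemma reduced_det_cong: "(\<And>i. i \<in> A \<Longrightarrow> g i = g' i) \<Longrightarrow> reduced_det A g = reduced_det A g'"
  by (simp add: reduced_det_def cong: if_cong)

lemma reduced_det_UNIV: "reduced_det UNIV g = of_int (polarized_det g)"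
  by (simp add: reduced_det_def)

lemma abs_reduced_det_empty: "\<bar>reduced_det {} g\<bar> = 1"
  by (simp add: reduced_det_def abs_divide flip: of_int_abs) (simp add: abs_polarized_det_zero)

text \<open>
  For \<open>g a \<noteq> 0\<close> this is the vanishing of the sum over all shifts by \<open>g a\<close>, applied to \<open>g\<close>
  restricted to \<open>A - {a}\<close>: a shift inside \<open>A - {a}\<close> merges \<open>a\<close> with that element, and a shift at
  any of the zero positions recovers, by symmetry, \<open>g\<close> restricted to \<open>A\<close>. For \<open>g a = 0\<close> all
  terms are equal up to the normalizing factorials.
\<close>
lemma reduced_det_merge:
  fixes g :: "'g::{finite,ab_group_add} \<Rightarrow> 'g"
  assumes a: "a \<in> A"
  shows "reduced_det A g = (if g a = 0 then of_nat CARD('g) * reduced_det (A - {a}) g else 0)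
    - (\<Sum>i\<in>A - {a}. reduced_det (A - {a}) (g(i := g i + g a)))"
proof -
  let ?B = "A - {a}" and ?N = "CARD('g)"
  let ?P = "\<lambda>C g. polarized_det (\<lambda>i. if i \<in> C then g i else 0 :: 'g)"
  have finA: "finite A" by simp
  have cB: "card A = Suc (card ?B)" using card_Suc_Diff1[OF finA a] by simp
  have le: "card A \<le> ?N" by (rule card_mono) auto
  have diff: "?N - card ?B = Suc (?N - card A)" using cB le by simp
  have f: "fact (?N - card ?B) = of_nat (?N - card ?B) * (fact (?N - card A) :: rat)"
    unfolding diff by simp
  have pos: "of_nat (?N - card ?B) \<noteq> (0::rat)" using diff by simp
  have div: "x / c = y / (m * c)" if "m * x = y" "m \<noteq> 0" for x y m c :: rat
    using that by auto
  show ?thesis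
  proof (cases "g a = 0")
    case True
    have "(\<lambda>i. if i \<in> A then g i else 0) = (\<lambda>i. if i \<in> ?B then g i else 0)"
      using True by auto
    then have "reduced_det A g = of_nat (?N - card ?B) * reduced_det ?B g"
      using pos by (simp add: reduced_det_def f)
    also have "of_nat (?N - card ?B) = (of_nat ?N - of_nat (card ?B) :: rat)"
      using cB le by (simp add: of_nat_diff)
    finally show ?thesis using True by (simp add: algebra_simps)
  next
    case False
    define u where "u = (\<lambda>i. if i \<in> ?B then g i else 0)"
    have in_B: "polarized_det (u(i := u i + g a)) = ?P ?B (g(i := g i + g a))" if "i \<in> ?B" for i
      using that by (intro arg_cong[of _ _ polarized_det]) (auto simp: u_def)
    have notin_B: "polarized_det (u(i := u i + g a)) = ?P A g" if "i \<in> - ?B" for i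
    proof -
      have "u(i := u i + g a) = (\<lambda>i. if i \<in> A then g i else 0) \<circ> Transposition.transpose i a"
        using that a by (auto simp: u_def fun_eq_iff Transposition.transpose_def)
      then show ?thesis by (simp add: polarized_det_compose permutes_swap_id)
    qed
    have "0 = (\<Sum>i\<in>UNIV. polarized_det (u(i := u i + g a)))"
      using sum_polarized_det_shift[OF False] by simp
    also have "\<dots> = (\<Sum>i\<in>?B. polarized_det (u(i := u i + g a)))
        + (\<Sum>i\<in>- ?B. polarized_det (u(i := u i + g a)))"
      by (subst sum.union_disjoint[symmetric]) (auto intro: sum.cong)
    also have "\<dots> = (\<Sum>i\<in>?B. ?P ?B (g(i := g i + g a))) + int (card (- ?B)) * ?P A g"
      using in_B notin_B by simp
    also have "card (- ?B) = ?N - card ?B" by (simp add: Compl_eq_Diff_UNIV card_Diff_subset)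
    finally have "int (?N - card ?B) * ?P A g = - (\<Sum>i\<in>?B. ?P ?B (g(i := g i + g a)))" by simp
    from arg_cong[OF this, of "of_int :: int \<Rightarrow> rat"]
    have "of_nat (?N - card ?B) * of_int (?P A g)
        = - (\<Sum>i\<in>?B. of_int (?P ?B (g(i := g i + g a))) :: rat)"
      by (simp only: of_int_minus of_int_mult of_int_of_nat_eq of_int_sum)
    then have "reduced_det A g
        = - (\<Sum>i\<in>?B. of_int (?P ?B (g(i := g i + g a)))) / fact (?N - card ?B)"
      unfolding reduced_det_def f by (rule div[OF _ pos])
    then show ?thesis
      using False by (simp add: reduced_det_def sum_divide_distrib)
  qed
qed

text \<open>
  Here \<open>insert a T\<close> is the support of the cycle through \<open>a\<close> in the formula
  $\sum_\pi \mathrm{sgn}(\pi)\, N^{c(\pi)}$. There are \<open>fact (card T)\<close> cycles with this support,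
  each of sign \<open>(- 1) ^ card T\<close>, and each contributes the factor $N$. The proof unwinds the
  merging recursion: in the term where \<open>a\<close> is merged with \<open>i\<close>, the induction hypothesis splits
  off the cycle through \<open>i\<close>. A given nonempty \<open>T\<close> arises once for each of its elements \<open>i\<close>,
  which turns \<open>fact (card T - 1)\<close> into \<open>fact (card T)\<close>.
\<close>
lemma reduced_det_block:
  fixes g :: "'g::{finite,ab_group_add} \<Rightarrow> 'g"
  assumes "a \<in> A"
  shows "reduced_det A g = (\<Sum>T | T \<subseteq> A - {a} \<and> g a + sum g T = 0.
    (- 1) ^ card T * fact (card T) * of_nat CARD('g) * reduced_det (A - {a} - T) g)"
  using assms
proof (induction "card A" arbitrary: A a g rule: less_induct)
  case less
  let ?B = "A - {a}" and ?N = "of_nat CARD('g) :: rat"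
  let ?c = "\<lambda>k. (- 1) ^ k * fact k * ?N"
  let ?T = "{T. T \<subseteq> ?B \<and> g a + sum g T = 0}"
  have IH: "reduced_det ?B (g(i := g i + g a))
      = (\<Sum>T | T \<in> ?T \<and> i \<in> T. ?c (card T - 1) * reduced_det (?B - T) g)" if i: "i \<in> ?B" for i
  proof -
    let ?g = "g(i := g i + g a)"
    have "reduced_det ?B ?g = (\<Sum>S | S \<subseteq> ?B - {i} \<and> ?g i + sum ?g S = 0.
        ?c (card S) * reduced_det (?B - {i} - S) ?g)"
      by (rule less.hyps[OF _ i]) (rule card_Diff1_less, use less.prems in auto)
    also have "\<dots> = (\<Sum>T | T \<in> ?T \<and> i \<in> T. ?c (card T - 1) * reduced_det (?B - T) g)"
    proof (rule sum.reindex_bij_witness[of _ "\<lambda>T. T - {i}" "insert i"])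
      fix S assume S: "S \<in> {S. S \<subseteq> ?B - {i} \<and> ?g i + sum ?g S = 0}"
      then have iS: "i \<notin> S" by auto
      then have g: "sum ?g S = sum g S" by (intro sum.cong) auto
      show "insert i S - {i} = S" using iS by auto
      show "insert i S \<in> {T. T \<in> ?T \<and> i \<in> T}" using S i iS g by (auto simp: ac_simps)
      have "reduced_det (?B - {i} - S) ?g = reduced_det (?B - insert i S) g"
        unfolding Diff_insert2[of ?B i S] by (rule reduced_det_cong) auto
      then show "?c (card (insert i S) - 1) * reduced_det (?B - insert i S) g
          = ?c (card S) * reduced_det (?B - {i} - S) ?g" using iS by simp
    next
      fix T assume T: "T \<in> {T. T \<in> ?T \<and> i \<in> T}"
      then show "insert i (T - {i}) = T" by auto
      have "sum ?g (T - {i}) = sum g (T - {i})" by (intro sum.cong) auto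
      moreover have "sum g T = g i + sum g (T - {i})" using T by (intro sum.remove) auto
      ultimately show "T - {i} \<in> {S. S \<subseteq> ?B - {i} \<and> ?g i + sum ?g S = 0}"
        using T by (auto simp: ac_simps)
    qed
    finally show ?thesis .
  qed
  have "(\<Sum>i\<in>?B. reduced_det ?B (g(i := g i + g a)))
      = (\<Sum>i\<in>?B. \<Sum>T | T \<in> ?T \<and> i \<in> T. ?c (card T - 1) * reduced_det (?B - T) g)"
    by (intro sum.cong refl IH)
  also have "\<dots> = (\<Sum>T\<in>?T. \<Sum>i | i \<in> ?B \<and> i \<in> T. ?c (card T - 1) * reduced_det (?B - T) g)"
    by (rule sum.swap_restrict) auto
  also have "\<dots> = (\<Sum>T\<in>?T. of_nat (card T) * (?c (card T - 1) * reduced_det (?B - T) g))"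
  proof (rule sum.cong[OF refl])
    fix T assume "T \<in> ?T"
    then have "{i. i \<in> ?B \<and> i \<in> T} = T" by auto
    then show "(\<Sum>i | i \<in> ?B \<and> i \<in> T. ?c (card T - 1) * reduced_det (?B - T) g)
        = of_nat (card T) * (?c (card T - 1) * reduced_det (?B - T) g)" by simp
  qed
  also have "\<dots> = (\<Sum>T\<in>?T - {{}}. of_nat (card T) * (?c (card T - 1) * reduced_det (?B - T) g))"
    by (rule sum.mono_neutral_right) auto
  also have "\<dots> = (\<Sum>T\<in>?T - {{}}. - (?c (card T) * reduced_det (?B - T) g))"
  proof (rule sum.cong[OF refl])
    fix T assume "T \<in> ?T - {{}}"
    then have "card T > 0" by (simp add: card_gt_0_iff)
    then obtain k where "card T = Suc k" using gr0_implies_Suc by blast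
    then show "of_nat (card T) * (?c (card T - 1) * reduced_det (?B - T) g)
        = - (?c (card T) * reduced_det (?B - T) g)" by simp
  qed
  finally have sum: "(\<Sum>i\<in>?B. reduced_det ?B (g(i := g i + g a)))
      = - (\<Sum>T\<in>?T - {{}}. ?c (card T) * reduced_det (?B - T) g)" by (simp add: sum_negf)
  have "(\<Sum>T\<in>?T. ?c (card T) * reduced_det (?B - T) g)
      = (if g a = 0 then ?N * reduced_det ?B g else 0)
        + (\<Sum>T\<in>?T - {{}}. ?c (card T) * reduced_det (?B - T) g)"
    by (cases "g a = 0") (simp_all add: sum.remove[of _ "{}"])
  with reduced_det_merge[OF less.prems, of g] sum show ?case by simp
qed

section \<open>Nonvanishing for groups of prime power order\<close>

text \<open>
  In the block recursion the term \<open>T = A - {a}\<close> is \<open>CARD('g) * fact (card A - 1)\<close> up to sign.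
  Every other term leaves a nonempty rest \<open>C\<close> on which \<open>g\<close> also has sum $0$, so the induction
  hypothesis applies to \<open>C\<close>. The extra factor \<open>CARD('g) = p ^ k\<close> makes the valuation of this term
  strictly larger than that of the term \<open>T = A - {a}\<close>.
\<close>
lemma reduced_det_multiplicity:
  fixes g :: "'g::{finite,ab_group_add} \<Rightarrow> 'g"
  assumes p: "prime p" and N: "CARD('g) = p ^ k"
    and "A \<noteq> {}" and "sum g A = 0"
  defines "v \<equiv> \<lambda>r. multiplicity p (CARD('g) * fact (r - 1))"
  shows "\<exists>z. reduced_det A g = of_int z \<and> int p ^ v (card A) dvd z \<and> \<not> int p ^ Suc (v (card A)) dvd z"
  using assms(3,4)
proof (induction "card A" arbitrary: A rule: less_induct)
  case less
  obtain a where a: "a \<in> A" using less.prems by auto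
  let ?B = "A - {a}"
  let ?T = "{T. T \<subseteq> ?B \<and> g a + sum g T = 0}"
  let ?N = "CARD('g)"
  let ?t = "\<lambda>T. (- 1) ^ card T * fact (card T) * of_nat ?N * reduced_det (?B - T) g"
  define w where "w = v (card A)"
  have cA: "card A = Suc (card ?B)" using card_Suc_Diff1[of A a] a by simp
  have cN: "card A \<le> ?N" by (rule card_mono) auto
  have sumB: "g a + sum g ?B = 0" using less.prems a sum.remove[of A a g] by simp
  have "\<exists>z. ?t T = of_int z \<and> int p ^ Suc w dvd z" if T: "T \<in> ?T - {?B}" for T
  proof -
    let ?C = "?B - T"
    have ne: "?C \<noteq> {}" using T by auto
    have cC: "card ?B = card T + card ?C"
      using T by (auto simp: card_Diff_subset card_mono)
    have "sum g ?B = sum g T + sum g ?C"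
      using T sum.subset_diff[of T ?B g] by (simp add: add.commute)
    moreover have "g a + sum g T = 0" using T by simp
    ultimately have "sum g ?C = 0" using sumB by (simp flip: add.assoc)
    moreover have "card ?C < card A" using cA cC by simp
    ultimately obtain z where z: "reduced_det ?C g = of_int z" "int p ^ v (card ?C) dvd z"
      using less.hyps[of ?C] ne by auto
    define s t where "s = card T" and "t = card ?C - 1"
    have "card ?C > 0" using ne by (simp add: card_gt_0_iff)
    then have st: "card ?B = Suc (s + t)" using cC by (simp add: s_def t_def)
    have lt: "Suc (s + t) < p ^ k" using st cA cN N by simp
    have pe: "prime_elem p" using p by simp
    have "Suc w \<le> multiplicity p (fact s * ?N) + v (card ?C)"
    proof -
      have "w = k + multiplicity p (fact (Suc (s + t)) :: nat)"
        unfolding w_def v_def cA st N using pe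
        by (subst prime_elem_multiplicity_mult_distrib) (auto simp del: fact_Suc)
      moreover have "v (card ?C) = k + multiplicity p (fact t :: nat)"
        unfolding v_def t_def N using pe
        by (subst prime_elem_multiplicity_mult_distrib) (auto simp del: fact_Suc)
      moreover have "multiplicity p (fact s * ?N) = multiplicity p (fact s :: nat) + k"
        unfolding N using pe
        by (subst prime_elem_multiplicity_mult_distrib) (auto simp del: fact_Suc)
      moreover have "multiplicity p (fact s * fact t :: nat)
          = multiplicity p (fact s :: nat) + multiplicity p (fact t :: nat)"
        using pe by (subst prime_elem_multiplicity_mult_distrib) (auto simp del: fact_Suc)
      ultimately show ?thesis using multiplicity_fact_Suc_add_less[OF p lt] by linarith
    qed
    then have "int p ^ Suc w dvd int p ^ multiplicity p (fact s * ?N) * int p ^ v (card ?C)"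
      by (simp only: power_add[symmetric] le_imp_power_dvd)
    also have "\<dots> dvd int (fact s * ?N) * z"
      using z(2) multiplicity_dvd[of p "fact s * ?N"]
      by (intro mult_dvd_mono) (simp_all only: of_nat_power[symmetric] of_nat_dvd_iff)
    also have "\<dots> dvd (- 1) ^ s * (int (fact s * ?N) * z)" by simp
    finally have "int p ^ Suc w dvd (- 1) ^ s * (int (fact s * ?N) * z)" .
    moreover have "?t T = of_int ((- 1) ^ s * (int (fact s * ?N) * z))"
      by (simp add: z(1) s_def)
    ultimately show ?thesis by blast
  qed
  then have "\<exists>z. \<forall>T\<in>?T - {?B}. ?t T = of_int (z T) \<and> int p ^ Suc w dvd z T"
    by (intro bchoice ballI)
  then obtain z where z: "\<And>T. T \<in> ?T - {?B} \<Longrightarrow> ?t T = of_int (z T)"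
    and p_dvd_z: "\<And>T. T \<in> ?T - {?B} \<Longrightarrow> int p ^ Suc w dvd z T"
    by blast
  have "reduced_det {} g = 1 \<or> reduced_det {} g = - 1"
    using abs_reduced_det_empty[of g] by linarith
  then obtain e :: int where e: "reduced_det {} g = of_int e" "\<bar>e\<bar> = 1"
    using that[of 1] that[of "- 1"] by auto
  define m where "m = (- 1) ^ card ?B * (e * int (?N * fact (card A - 1)))"
  define y where "y = sum z (?T - {?B})"
  have "reduced_det A g = ?t ?B + (\<Sum>T\<in>?T - {?B}. ?t T)"
    unfolding reduced_det_block[OF a] using sumB by (intro sum.remove) auto
  also have "?t ?B = of_int m" by (simp add: m_def e cA)
  also have "(\<Sum>T\<in>?T - {?B}. ?t T) = of_int y"
    unfolding y_def of_int_sum by (rule sum.cong[OF refl z])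
  finally have "reduced_det A g = of_int (m + y)" by simp
  moreover have y: "int p ^ Suc w dvd y" unfolding y_def by (rule dvd_sum) (rule p_dvd_z)
  moreover have "int p ^ w dvd y" using y by (rule power_le_dvd) simp
  moreover have dvd_m: "q dvd m \<longleftrightarrow> q dvd int (?N * fact (card A - 1))" for q
  proof -
    have "\<bar>m\<bar> = \<bar>int (?N * fact (card A - 1))\<bar>" by (simp add: m_def abs_mult power_abs e)
    then show ?thesis by (metis dvd_abs_iff)
  qed
  have m: "int p ^ w dvd m" "\<not> int p ^ Suc w dvd m"
  proof -
    have "p ^ w dvd ?N * fact (card A - 1)" unfolding w_def v_def by (rule multiplicity_dvd)
    then show "int p ^ w dvd m" unfolding dvd_m by (simp only: of_nat_power[symmetric] of_nat_dvd_iff)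
    have "\<not> p ^ Suc w dvd ?N * fact (card A - 1)"
      unfolding w_def v_def using p by (subst power_dvd_iff_le_multiplicity) auto
    then show "\<not> int p ^ Suc w dvd m"
      unfolding dvd_m by (simp only: of_nat_power[symmetric] of_nat_dvd_iff) simp
  qed
  ultimately show ?case
    unfolding w_def[symmetric] by (intro exI[of _ "m + y"]) (simp add: dvd_add_left_iff)
qed

lemma polarized_det_nonzero:
  fixes g :: "'g::{finite,ab_group_add} \<Rightarrow> 'g"
  assumes "primepow CARD('g)" and "sum g UNIV = 0"
  shows "polarized_det g \<noteq> 0"
proof -
  obtain p k where "prime p" "CARD('g) = p ^ k" using assms(1) by (auto simp: primepow_def)
  from reduced_det_multiplicity[OF this UNIV_not_empty assms(2)]
  show ?thesis by (auto simp: reduced_det_UNIV)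
qed

section \<open>Coefficients of the permanent and the determinant\<close>

abbreviation cayley_permanent :: "'g::{finite,ab_group_add} intpoly" where
  "cayley_permanent \<equiv> permanent (cayley_table :: 'g intpoly^('g::{finite,ab_group_add})^('g::{finite,ab_group_add}))"

abbreviation cayley_det :: "'g::{finite,ab_group_add} intpoly" where
  "cayley_det \<equiv> det (cayley_table :: 'g intpoly^('g::{finite,ab_group_add})^('g::{finite,ab_group_add}))"

definition value_monomial :: "('g::finite \<Rightarrow> 'g) \<Rightarrow> 'g monomial" where
  "value_monomial f = (\<Sum>a\<in>UNIV. Poly_Mapping.single (f a) 1)"

lemma prod_indet: "(\<Prod>a\<in>A. indet (f a)) = Poly_Mapping.single (\<Sum>a\<in>A. Poly_Mapping.single (f a) 1) 1"
  by (induction A rule: infinite_finite_induct) (simp_all add: indet_def mult_single)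

lemma lookup_permanent_cayley_table:
  "Poly_Mapping.lookup (cayley_permanent :: 'g::{finite,ab_group_add} intpoly) m
    = (\<Sum>\<sigma> | \<sigma> permutes UNIV. if value_monomial (\<lambda>a. a + \<sigma> a) = m then 1 else 0)"
  by (simp add: permanent_def cayley_table_def prod_indet lookup_sum lookup_single value_monomial_def
      when_def eq_commute[of m])

lemma lookup_det_cayley_table:
  "Poly_Mapping.lookup (cayley_det :: 'g::{finite,ab_group_add} intpoly) m
    = (\<Sum>\<sigma> | \<sigma> permutes UNIV. if value_monomial (\<lambda>a. a + \<sigma> a) = m then sign \<sigma> else 0)"
proof -
  have "of_int s * Poly_Mapping.single l 1 = Poly_Mapping.single l s" for s :: int and l :: "'g monomial"
    by (simp add: mult_single flip: single_of_int)
  then show ?thesis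
    by (simp add: det_def cayley_table_def prod_indet lookup_sum lookup_single value_monomial_def
      when_def eq_commute[of m])
qed

lemma value_monomial_eqE:
  assumes "value_monomial f = value_monomial g"
  obtains \<delta> where "\<delta> permutes UNIV" "g = f \<circ> \<delta>"
proof -
  have l: "Poly_Mapping.lookup (value_monomial f) v = card {a. f a = v}" for f :: "'a \<Rightarrow> 'a" and v
    by (simp add: value_monomial_def lookup_sum lookup_single when_def sum.If_cases)
  have "image_mset g (mset_set UNIV) = image_mset f (mset_set UNIV)"
  proof (rule multiset_eqI)
    fix v
    have "card {a. f a = v} = card {a. g a = v}" using assms l by metis
    then show "count (image_mset g (mset_set UNIV)) v = count (image_mset f (mset_set UNIV)) v"
      by (simp add: count_image_mset' eq_commute[of v])
  qed
  from image_mset_eq_implies_permutes[OF finite this]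
  show ?thesis using that by (metis UNIV_I comp_apply ext)
qed

lemma value_monomial_compose:
  "\<delta> permutes UNIV \<Longrightarrow> value_monomial (f \<circ> \<delta>) = value_monomial f"
  unfolding value_monomial_def comp_def by (rule sum.permute[symmetric, unfolded comp_def])

text \<open>
  Substituting \<open>\<beta> = \<sigma> \<circ> \<alpha>\<close> turns a pair with \<open>\<alpha> + \<beta> = g\<close> into a pair \<open>\<sigma>\<close>, \<open>\<alpha>\<close> such that
  \<open>\<alpha>\<close> carries the family \<open>a + \<sigma> a\<close> to \<open>g\<close>, and the product of the signs becomes \<open>sign \<sigma>\<close>. Such
  an \<open>\<alpha>\<close> exists only if the two families have the same monomial. In that case the possible
  \<open>\<alpha>\<close> form a coset of the stabilizer of \<open>g\<close>, so their number does not depend on \<open>\<sigma>\<close>.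
\<close>
lemma polarized_det_eq_coefficient:
  fixes g :: "'g::{finite,ab_group_add} \<Rightarrow> 'g"
  shows "polarized_det g = int (card {\<gamma>. \<gamma> permutes UNIV \<and> g \<circ> \<gamma> = g})
    * Poly_Mapping.lookup (cayley_det :: 'g intpoly) (value_monomial g)"
proof -
  let ?f = "\<lambda>\<sigma> a. a + \<sigma> a :: 'g"
  let ?K = "card {\<gamma>. \<gamma> permutes UNIV \<and> g \<circ> \<gamma> = g}"
  have fin: "finite {\<alpha>. \<alpha> permutes (UNIV :: 'g set)}" by (rule finite_permutations) simp
  have "sign \<alpha> * perm_sign (\<lambda>i. g i - \<alpha> i)
      = (\<Sum>\<sigma> | \<sigma> permutes UNIV. if ?f \<sigma> \<circ> \<alpha> = g then sign \<sigma> else 0)"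
    if a: "\<alpha> permutes UNIV" for \<alpha>
  proof -
    let ?\<tau> = "(\<lambda>i. g i - \<alpha> i) \<circ> inv \<alpha>"
    have eq: "?f \<sigma> \<circ> \<alpha> = g \<longleftrightarrow> \<sigma> = ?\<tau>" for \<sigma>
    proof
      assume "?f \<sigma> \<circ> \<alpha> = g"
      then have "g = ?f \<sigma> \<circ> \<alpha>" by (rule sym)
      then have "(\<lambda>i. g i - \<alpha> i) = \<sigma> \<circ> \<alpha>" by (simp add: fun_eq_iff)
      then show "\<sigma> = ?\<tau>" using a by (simp add: comp_assoc permutes_inv_o)
    next
      assume "\<sigma> = ?\<tau>"
      then show "?f \<sigma> \<circ> \<alpha> = g" using a by (simp add: fun_eq_iff permutes_inverses)
    qed
    have "(\<Sum>\<sigma> | \<sigma> permutes UNIV. if ?f \<sigma> \<circ> \<alpha> = g then sign \<sigma> else 0) = perm_sign ?\<tau>"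
      unfolding eq using fin by (simp add: perm_sign_def)
    also have "\<dots> = sign \<alpha> * perm_sign (\<lambda>i. g i - \<alpha> i)"
      using a by (simp add: perm_sign_compose permutes_inv sign_inverse permutes_imp_permutation[OF finite])
    finally show ?thesis by simp
  qed
  then have "polarized_det g = (\<Sum>\<alpha> | \<alpha> permutes UNIV. \<Sum>\<sigma> | \<sigma> permutes UNIV.
      if ?f \<sigma> \<circ> \<alpha> = g then sign \<sigma> else 0)"
    by (simp add: polarized_det_def)
  also have "\<dots> = (\<Sum>\<sigma> | \<sigma> permutes UNIV. \<Sum>\<alpha> | \<alpha> permutes UNIV.
      if ?f \<sigma> \<circ> \<alpha> = g then sign \<sigma> else 0)"
    by (rule sum.swap)
  also have "\<dots> = (\<Sum>\<sigma> | \<sigma> permutes UNIV.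
      int ?K * (if value_monomial (?f \<sigma>) = value_monomial g then sign \<sigma> else 0))"
  proof (rule sum.cong[OF refl])
    fix \<sigma> :: "'g \<Rightarrow> 'g"
    have 1: "(\<Sum>\<alpha> | \<alpha> permutes UNIV. if ?f \<sigma> \<circ> \<alpha> = g then sign \<sigma> else 0)
        = int (card {\<alpha>. \<alpha> permutes UNIV \<and> ?f \<sigma> \<circ> \<alpha> = g}) * sign \<sigma>"
      using fin by (simp add: sum.If_cases Collect_conj_eq)
    show "(\<Sum>\<alpha> | \<alpha> permutes UNIV. if ?f \<sigma> \<circ> \<alpha> = g then sign \<sigma> else 0)
        = int ?K * (if value_monomial (?f \<sigma>) = value_monomial g then sign \<sigma> else 0)"
    proof (cases "value_monomial (?f \<sigma>) = value_monomial g")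
      case True
      then obtain \<delta> where d: "\<delta> permutes UNIV" "g = ?f \<sigma> \<circ> \<delta>" by (rule value_monomial_eqE)
      have "bij_betw (\<lambda>\<gamma>. \<delta> \<circ> \<gamma>) {\<gamma>. \<gamma> permutes UNIV \<and> g \<circ> \<gamma> = g}
          {\<alpha>. \<alpha> permutes UNIV \<and> ?f \<sigma> \<circ> \<alpha> = g}"
      proof (rule bij_betw_byWitness[of _ "\<lambda>\<alpha>. inv \<delta> \<circ> \<alpha>"])
        have id: "\<delta> \<circ> (inv \<delta> \<circ> x) = x" "inv \<delta> \<circ> (\<delta> \<circ> x) = x" for x :: "'g \<Rightarrow> 'g"
          using d(1) by (simp_all add: fun_eq_iff permutes_inverses)
        show "\<forall>\<gamma>\<in>{\<gamma>. \<gamma> permutes UNIV \<and> g \<circ> \<gamma> = g}. inv \<delta> \<circ> (\<delta> \<circ> \<gamma>) = \<gamma>"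
          "\<forall>\<alpha>\<in>{\<alpha>. \<alpha> permutes UNIV \<and> ?f \<sigma> \<circ> \<alpha> = g}. \<delta> \<circ> (inv \<delta> \<circ> \<alpha>) = \<alpha>"
          by (simp_all add: id)
        show "(\<lambda>\<gamma>. \<delta> \<circ> \<gamma>) ` {\<gamma>. \<gamma> permutes UNIV \<and> g \<circ> \<gamma> = g}
            \<subseteq> {\<alpha>. \<alpha> permutes UNIV \<and> ?f \<sigma> \<circ> \<alpha> = g}"
          using d by (auto simp: permutes_compose comp_assoc[symmetric])
        show "(\<lambda>\<alpha>. inv \<delta> \<circ> \<alpha>) ` {\<alpha>. \<alpha> permutes UNIV \<and> ?f \<sigma> \<circ> \<alpha> = g}
            \<subseteq> {\<gamma>. \<gamma> permutes UNIV \<and> g \<circ> \<gamma> = g}"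
          using d(1) by (auto simp: permutes_compose permutes_inv d(2) comp_assoc id)
      qed
      then show ?thesis using True 1 by (simp add: bij_betw_same_card)
    next
      case False
      then have none: "{\<alpha>. \<alpha> permutes UNIV \<and> ?f \<sigma> \<circ> \<alpha> = g} = {}"
        using False value_monomial_compose[of _ "?f \<sigma>"] by auto
      show ?thesis unfolding 1 none using False by simp
    qed
  qed
  finally show ?thesis
    by (simp only: lookup_det_cayley_table sum_distrib_left)
qed

text \<open>
  A family \<open>a + \<sigma> a\<close> has sum \<open>(\<Sum>a\<in>UNIV. a) + (\<Sum>a\<in>UNIV. a)\<close>, and this is $0$ because
  negation permutes the group.
\<close>
lemma keys_permanent_subset_keys_det:
  assumes "primepow CARD('g::{finite,ab_group_add})"
  shows "Poly_Mapping.keys (cayley_permanent :: 'g intpoly)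
    \<subseteq> Poly_Mapping.keys (cayley_det :: 'g intpoly)"
proof
  fix m assume "m \<in> Poly_Mapping.keys (cayley_permanent :: 'g intpoly)"
  then obtain \<sigma> :: "'g \<Rightarrow> 'g" where s: "\<sigma> permutes UNIV" and m: "value_monomial (\<lambda>a. a + \<sigma> a) = m"
    by (auto simp: in_keys_iff lookup_permanent_cayley_table elim: sum.not_neutral_contains_not_neutral
        split: if_splits)
  have "(\<Sum>a\<in>UNIV. \<sigma> a) = (\<Sum>a\<in>UNIV. a)"
    using sum.permute[OF s, of "\<lambda>a. a"] by (simp add: comp_def)
  also have "\<dots> = (\<Sum>a\<in>UNIV. - a :: 'g)"
    by (rule sum.reindex_bij_witness[of _ uminus uminus]) auto
  finally have "(\<Sum>a\<in>UNIV. a + \<sigma> a) = 0" by (simp add: sum.distrib sum_negf)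
  with assms have "polarized_det (\<lambda>a. a + \<sigma> a) \<noteq> 0" by (rule polarized_det_nonzero)
  then show "m \<in> Poly_Mapping.keys (cayley_det :: 'g intpoly)"
    by (auto simp: in_keys_iff polarized_det_eq_coefficient m)
qed

lemma keys_det_subset_keys_permanent:
  "Poly_Mapping.keys (cayley_det :: 'g::{finite,ab_group_add} intpoly)
    \<subseteq> Poly_Mapping.keys (cayley_permanent :: 'g intpoly)"
proof
  fix m assume "m \<in> Poly_Mapping.keys (cayley_det :: 'g intpoly)"
  then obtain \<sigma> :: "'g \<Rightarrow> 'g" where s: "\<sigma> permutes UNIV" and m: "value_monomial (\<lambda>a. a + \<sigma> a) = m"
    by (auto simp: in_keys_iff lookup_det_cayley_table elim: sum.not_neutral_contains_not_neutral
        split: if_splits)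
  have "finite {\<sigma>. \<sigma> permutes (UNIV :: 'g set)}" by (rule finite_permutations) simp
  then have "(\<Sum>\<sigma> | \<sigma> permutes (UNIV :: 'g set). if value_monomial (\<lambda>a. a + \<sigma> a) = m then 1 else 0 :: int) > 0"
    using s m by (intro sum_pos2[of _ \<sigma>]) auto
  then show "m \<in> Poly_Mapping.keys (cayley_permanent :: 'g intpoly)"
    by (simp add: in_keys_iff lookup_permanent_cayley_table)
qed

theorem theorem1p3:
  assumes "primepow CARD('g::{finite,ab_group_add})"
  shows "per_monomials TYPE('g) = det_monomials TYPE('g)"
  unfolding per_monomials_def det_monomials_def num_monomials_def
  using keys_permanent_subset_keys_det[OF assms] keys_det_subset_keys_permanent[where 'g = 'g]
  by (intro arg_cong[of _ _ card]) (rule subset_antisym)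

end
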